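(* Let $\mathsf{R}$ be an ordered ring with $\frac12\in\mathsf{R}$, $\mathsf{C}=\mathsf{R}(\mathrm{i})$, let $\mathcal{A}$ be a $^*$-algebra over $\mathsf{C}$ with product $\mu_0$, let $r\ge 1$, and let $\mu_0+\lambda\mu_1+\dots+\lambda^{r-1}\mu_{r-1}$ be a Hermitian deformation of $\mathcal{A}$ up to order $r-1$. Define $E_r\in C^3(\mathcal{A})$ by $$E_r(A\otimes B\otimes C)=\sum_{s=1}^{r-1}\Big(\mu_s\big(\mu_{r-s}(A\otimes B)\otimes C\big)-\mu_s\big(A\otimes\mu_{r-s}(B\otimes C)\big)\Big).$$ Then: (1) The obstruction to extending to a Hermitian deformation up to order $r$ lies in the Hermitian Hochschild cohomology $H^3_H(\mathcal{A})$: $\mathrm{i}E_r$ is a Hermitian Hochschild $3$-cocycle, and there exists $\mu_r\in C^2(\mathcal{A})$ such that $\mu_0+\lambda\mu_1+\dots+\lambda^r\mu_r$ is a Hermitian deformation up to order $r$ if and only if the class $[\mathrm{i}E_r]\in H^3_H(\mathcal{A})$ vanishes. (2) If there exists $\mu_r\in C^2(\mathcal{A})$ such that $\mu_0+\lambda\mu_1+\dots+\lambda^r\mu_r$ is an associative deformation up to order $r$, then there also exists $\mu_r'\in C^2(\mathcal{A})$ such that $\mu_0+\lambda\mu_1+\dots+\lambda^{r-1}\mu_{r-1}+\lambda^r\mu_r'$ is a Hermitian deformation up to order $r$.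
   Context: An ordered ring is an associative, commutative, unital ring $\mathsf{R}$ with a subset $\mathsf{P}\subset\mathsf{R}$ such that $\mathsf{R}$ is the disjoint union $-\mathsf{P}\cup\{0\}\cup\mathsf{P}$, $\mathsf{P}\cdot\mathsf{P}\subseteq\mathsf{P}$ and $\mathsf{P}+\mathsf{P}\subseteq\mathsf{P}$. $\mathsf{C}=\mathsf{R}(\mathrm{i})$ with $\mathrm{i}^2=-1$ is the quadratic ring extension, with conjugation $\overline{a+\mathrm{i}b}=a-\mathrm{i}b$. A $^*$-algebra over $\mathsf{C}$ is an associative $\mathsf{C}$-algebra $\mathcal{A}$ (product $\mu_0$) with an involutive $\mathsf{C}$-antilinear anti-automorphism $A\mapsto A^*$. $C^n(\mathcal{A})=\mathrm{Hom}_{\mathsf{C}}(\mathcal{A}^{\otimes n},\mathcal{A})$ are the Hochschild $n$-cochains, with Hochschild differential $$(\delta\varphi)(A_1\otimes\cdots\otimes A_{n+1})=A_1\varphi(A_2\otimes\cdots\otimes A_{n+1})+\sum_{i=1}^n(-1)^i\varphi(A_1\otimes\cdots\otimes A_iA_{i+1}\otimes\cdots\otimes A_{n+1})+(-1)^{n+1}\varphi(A_1\otimes\cdots\otimes A_n)A_{n+1}.$$ For $\varphi\in C^n(\mathcal{A})$ let $\varphi^*(A_1\otimes\cdots\otimes A_n):=(\varphi(A_n^*\otimes\cdots\otimes A_1^* ))^*$. Call $\varphi$ Hermitian if $\varphi^*=\varphi$ and anti-Hermitian if $\varphi^*=-\varphi$. Let $Z^n_H(\mathcal{A})$ be the $\mathsf{R}$-module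 of Hermitian cocycles. Let $B^n_H(\mathcal{A})$ be the set of Hermitian coboundaries $\delta\psi$ with $\psi\in C^{n-1}(\mathcal{A})$ Hermitian if $n$ is even and anti-Hermitian if $n$ is odd. Set $H^n_H(\mathcal{A})=Z^n_H(\mathcal{A})/B^n_H(\mathcal{A})$. An associative deformation up to order $k$ is a family $\mu_1,\dots,\mu_k\in C^2(\mathcal{A})$ such that the $\mathsf{C}[[\lambda]]$-bilinear product $\mu_0+\lambda\mu_1+\dots+\lambda^k\mu_k$ is associative modulo $\lambda^{k+1}$. It is a Hermitian deformation up to order $k$ if in addition $\mu_j^*=\mu_j$ for $j=1,\dots,k$ (the $^*$-involution is not deformed). *)

theory Defs
  imports
    "HOL-Library.Function_Algebras"
    "HOL-Computational_Algebra.Formal_Power_Series"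
begin

section \<open>The quadratic extension of a commutative ring by a square root of minus one\<close>

datatype 'r qext = QExt (re: 'r) (im: 'r)

lemma qext_eq_iff: "z = w \<longleftrightarrow> re z = re w \<and> im z = im w"
  by (cases z; cases w) auto

instantiation qext :: (comm_ring_1) comm_ring_1
begin

definition "0 = QExt 0 0"
definition "1 = QExt 1 0"
definition "z + w = QExt (re z + re w) (im z + im w)"
definition "z - w = QExt (re z - re w) (im z - im w)"
definition "- z = QExt (- re z) (- im z)"
definition "z * w = QExt (re z * re w - im z * im w) (re z * im w + im z * re w)"

instance
  by standard
    (auto simp: qext_eq_iff zero_qext_def one_qext_def plus_qext_def minus_qext_def
      uminus_qext_def times_qext_def algebra_simps)

end

definition imag_unit :: "'r::comm_ring_1 qext" where
  "imag_unit = QExt 0 1"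

definition qconj :: "'r::comm_ring_1 qext \<Rightarrow> 'r qext" where
  "qconj z = QExt (re z) (- im z)"

lemma imag_unit_square: "imag_unit * imag_unit = (- 1 :: 'r::comm_ring_1 qext)"
  by (simp add: imag_unit_def times_qext_def uminus_qext_def one_qext_def)


section \<open>Star-algebras\<close>

text \<open>
  The algebra is not required to have a unit. Ordered rings in the sense of a positive set
  \<open>P\<close> are the rings of class \<^class>\<open>linordered_idom\<close>, with \<open>P = {x. 0 < x}\<close>.
\<close>

locale star_algebra = module scale
  for scale :: "'r::linordered_idom qext \<Rightarrow> 'a::ring \<Rightarrow> 'a" +
  fixes star :: "'a \<Rightarrow> 'a"
  assumes scale_mult_left: "scale c A * B = scale c (A * B)"
    and scale_mult_right: "A * scale c B = scale c (A * B)"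
    and star_add: "star (A + B) = star A + star B"
    and star_scale: "star (scale c A) = scale (qconj c) (star A)"
    and star_mult: "star (A * B) = star B * star A"
    and star_star: "star (star A) = A"


section \<open>Hochschild cochains\<close>

text \<open>
  Linear maps out of the \<open>n\<close>-fold tensor power are represented by \<open>n\<close>-linear maps, the arguments
  being given as a list of length \<open>n\<close>. A cochain is normalised to \<open>0\<close> on all lists of other
  lengths, so that equality of cochains is equality of functions.
\<close>

definition cochains ::
    "('r::comm_ring_1 qext \<Rightarrow> 'a::ring \<Rightarrow> 'a) \<Rightarrow> nat \<Rightarrow> ('a list \<Rightarrow> 'a) set" where
  "cochains scale n = {\<phi>.
     (\<forall>As i. length As = n \<longrightarrow> i < n \<longrightarrow> module_hom scale scale (\<lambda>A. \<phi> (As[i := A]))) \<and>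
     (\<forall>As. length As \<noteq> n \<longrightarrow> \<phi> As = 0)}"

text \<open>
  The differential of an \<open>n\<close>-cochain. The list positions are \<open>0, \<dots>, n\<close>, so the \<open>i\<close>-th summand
  multiplies the entries at positions \<open>i - 1\<close> and \<open>i\<close>.
\<close>

definition hochschild_diff ::
    "('r::comm_ring_1 qext \<Rightarrow> 'a::ring \<Rightarrow> 'a) \<Rightarrow> nat \<Rightarrow> ('a list \<Rightarrow> 'a) \<Rightarrow> 'a list \<Rightarrow> 'a" where
  "hochschild_diff scale n \<phi> As =
    (if length As = n + 1 then
       hd As * \<phi> (tl As)
       + (\<Sum>i = 1..n. scale ((- 1) ^ i)
            (\<phi> (take (i - 1) As @ [As ! (i - 1) * As ! i] @ drop (i + 1) As)))
       + scale ((- 1) ^ (n + 1)) (\<phi> (butlast As) * last As)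
     else 0)"

definition cochain_star :: "('a \<Rightarrow> 'a) \<Rightarrow> ('a list \<Rightarrow> 'a) \<Rightarrow> 'a list \<Rightarrow> 'a" where
  "cochain_star star \<phi> As = star (\<phi> (map star (rev As)))"

definition hermitian :: "('a \<Rightarrow> 'a) \<Rightarrow> ('a list \<Rightarrow> 'a) \<Rightarrow> bool" where
  "hermitian star \<phi> \<longleftrightarrow> cochain_star star \<phi> = \<phi>"

definition anti_hermitian :: "('a \<Rightarrow> 'a) \<Rightarrow> ('a list \<Rightarrow> 'a::ring) \<Rightarrow> bool" where
  "anti_hermitian star \<phi> \<longleftrightarrow> cochain_star star \<phi> = - \<phi>"


section \<open>Hermitian Hochschild cohomology\<close>

definition herm_cocycles ::
    "('r::comm_ring_1 qext \<Rightarrow> 'a::ring \<Rightarrow> 'a) \<Rightarrow> ('a \<Rightarrow> 'a) \<Rightarrow> nat \<Rightarrow> ('a list \<Rightarrow> 'a) set" where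
  "herm_cocycles scale star n =
    {\<phi> \<in> cochains scale n. hochschild_diff scale n \<phi> = 0 \<and> hermitian star \<phi>}"

text \<open>In degree \<open>0\<close> there are no nonzero coboundaries, as there are no cochains of degree \<open>-1\<close>.\<close>

definition herm_coboundaries ::
    "('r::comm_ring_1 qext \<Rightarrow> 'a::ring \<Rightarrow> 'a) \<Rightarrow> ('a \<Rightarrow> 'a) \<Rightarrow> nat \<Rightarrow> ('a list \<Rightarrow> 'a) set" where
  "herm_coboundaries scale star n =
    (case n of
       0 \<Rightarrow> {0}
     | Suc m \<Rightarrow> {hochschild_diff scale m \<psi> | \<psi>. \<psi> \<in> cochains scale m \<and>
         (if even n then hermitian star \<psi> else anti_hermitian star \<psi>) \<and>
         hermitian star (hochschild_diff scale m \<psi>)})"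

definition herm_cohomologous ::
    "('r::comm_ring_1 qext \<Rightarrow> 'a::ring \<Rightarrow> 'a) \<Rightarrow> ('a \<Rightarrow> 'a) \<Rightarrow> nat \<Rightarrow>
      (('a list \<Rightarrow> 'a) \<times> ('a list \<Rightarrow> 'a)) set" where
  "herm_cohomologous scale star n =
    {(\<phi>, \<chi>). \<phi> \<in> herm_cocycles scale star n \<and> \<chi> \<in> herm_cocycles scale star n \<and>
       \<phi> - \<chi> \<in> herm_coboundaries scale star n}"

definition herm_cohomology ::
    "('r::comm_ring_1 qext \<Rightarrow> 'a::ring \<Rightarrow> 'a) \<Rightarrow> ('a \<Rightarrow> 'a) \<Rightarrow> nat \<Rightarrow> ('a list \<Rightarrow> 'a) set set" where
  "herm_cohomology scale star n =
    herm_cocycles scale star n // herm_cohomologous scale star n"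

definition herm_class ::
    "('r::comm_ring_1 qext \<Rightarrow> 'a::ring \<Rightarrow> 'a) \<Rightarrow> ('a \<Rightarrow> 'a) \<Rightarrow> nat \<Rightarrow>
      ('a list \<Rightarrow> 'a) \<Rightarrow> ('a list \<Rightarrow> 'a) set" where
  "herm_class scale star n \<phi> = herm_cohomologous scale star n `` {\<phi>}"


section \<open>Formal deformations\<close>

definition product_cochain :: "'a::ring list \<Rightarrow> 'a" where
  "product_cochain As = (if length As = 2 then As ! 0 * As ! 1 else 0)"

text \<open>
  The extension of \<open>\<mu> 0 + \<lambda> \<mu> 1 + \<dots> + \<lambda>^k \<mu> k\<close> to formal power series with coefficients in the
  algebra, bilinear over the formal power series in the scalars.
\<close>

definition deformed_product ::
    "(nat \<Rightarrow> 'a::ring list \<Rightarrow> 'a) \<Rightarrow> nat \<Rightarrow> 'a fps \<Rightarrow> 'a fps \<Rightarrow> 'a fps" where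
  "deformed_product \<mu> k a b =
    Abs_fps (\<lambda>n. \<Sum>s\<le>min k n. \<Sum>i\<le>n - s. \<mu> s [fps_nth a i, fps_nth b (n - s - i)])"

definition associative_deformation ::
    "('r::comm_ring_1 qext \<Rightarrow> 'a::ring \<Rightarrow> 'a) \<Rightarrow> nat \<Rightarrow> (nat \<Rightarrow> 'a list \<Rightarrow> 'a) \<Rightarrow> bool" where
  "associative_deformation scale k \<mu> \<longleftrightarrow>
    \<mu> 0 = product_cochain \<and>
    (\<forall>j\<in>{1..k}. \<mu> j \<in> cochains scale 2) \<and>
    (\<forall>a b c. \<forall>n<k + 1.
       fps_nth (deformed_product \<mu> k (deformed_product \<mu> k a b) c) n =
       fps_nth (deformed_product \<mu> k a (deformed_product \<mu> k b c)) n)"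

definition hermitian_deformation ::
    "('r::comm_ring_1 qext \<Rightarrow> 'a::ring \<Rightarrow> 'a) \<Rightarrow> ('a \<Rightarrow> 'a) \<Rightarrow> nat \<Rightarrow>
      (nat \<Rightarrow> 'a list \<Rightarrow> 'a) \<Rightarrow> bool" where
  "hermitian_deformation scale star k \<mu> \<longleftrightarrow>
    associative_deformation scale k \<mu> \<and> (\<forall>j\<in>{1..k}. hermitian star (\<mu> j))"

definition obstruction :: "(nat \<Rightarrow> 'a::ring list \<Rightarrow> 'a) \<Rightarrow> nat \<Rightarrow> 'a list \<Rightarrow> 'a" where
  "obstruction \<mu> r As =
    (case As of
       [A, B, C] \<Rightarrow> \<Sum>s = 1..r - 1. \<mu> s [\<mu> (r - s) [A, B], C] - \<mu> s [A, \<mu> (r - s) [B, C]]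
     | _ \<Rightarrow> 0)"

end

theory Submission
  imports Defs
begin

text \<open>
  At order \<open>r\<close> associativity of an extension by \<open>\<nu>\<close> reads \<open>\<delta>\<nu> = E\<close>, where \<open>E\<close> is the obstruction: the
  terms that contain \<open>\<nu>\<close> are those in which the other factor is the undeformed product, and they
  add up to \<open>- \<delta>\<nu>\<close> (\<open>associative_extension_iff\<close>).

  That \<open>\<delta>E = 0\<close> comes from the \<open>pentagon\<close> identity, a cancellation between the five associators
  of four elements that holds for every biadditive product. It is applied to the product
  \<open>\<mu> 0 + \<dots> + \<lambda>^(r - 1) \<mu> (r - 1)\<close>, whose associator on formal power series starts at order \<open>r\<close>.
  The associator is additive and commutes with multiplication by \<open>\<lambda>\<close> in each argument, so this
  lowest coefficient depends on the constant terms of the arguments alone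
  (\<open>associator_lowest_coeff\<close>); on constants it is \<open>E\<close>. Hence the coefficient of order \<open>r\<close> of the
  pentagon identity contains only \<open>E\<close> and the undeformed product, and is the cocycle equation.
  The same remark about lowest coefficients reduces associativity on power series to equations
  between elements of the algebra (\<open>associative_deformation_iff_coeff\<close>).

  The involution reverses the order of arguments and so exchanges the two ways of bracketing three
  factors. This gives \<open>E\<^sup>* = - E\<close> for Hermitian \<open>\<mu> s\<close>, and \<open>\<delta>(\<nu>\<^sup>*) = - (\<delta>\<nu>)\<^sup>*\<close> for 2-cochains.
  Because \<open>i\<close> is conjugated to \<open>- i\<close>, multiplication by \<open>i\<close> turns the anti-Hermitian \<open>E\<close> into a
  Hermitian cocycle and identifies Hermitian solutions of \<open>\<delta>\<nu> = E\<close> with anti-Hermitian solutions of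
  \<open>\<delta>\<psi> = iE\<close>; these witness that the class of \<open>iE\<close> vanishes. Finally, if \<open>\<delta>\<nu> = E\<close> then also
  \<open>\<delta>(\<nu>\<^sup>*) = - E\<^sup>* = E\<close>, so the Hermitian mean \<open>(\<nu> + \<nu>\<^sup>*)/2\<close> solves the equation whenever \<open>\<nu>\<close> does.
\<close>


section \<open>The pentagon identity for truncated formal products\<close>

text \<open>
  Multiplication of a power series by the formal parameter. As the algebra need not have a unit,
  it cannot be written as multiplication by the series \<open>\<lambda>\<close>.
\<close>

definition param_mult :: "'a::zero fps \<Rightarrow> 'a fps" where
  "param_mult y = Abs_fps (\<lambda>n. case n of 0 \<Rightarrow> 0 | Suc m \<Rightarrow> fps_nth y m)"

lemma param_mult_nth_0 [simp]: "fps_nth (param_mult y) 0 = 0"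
  and param_mult_nth_Suc [simp]: "fps_nth (param_mult y) (Suc n) = fps_nth y n"
  by (simp_all add: param_mult_def)

lemma fps_eq_const_plus_param_mult:
  fixes a :: "'a::ring fps"
  shows "a = fps_const (fps_nth a 0) + param_mult (fps_shift 1 a)"
proof (rule fps_ext)
  show "fps_nth a n = fps_nth (fps_const (fps_nth a 0) + param_mult (fps_shift 1 a)) n" for n
    by (cases n) auto
qed

lemma param_mult_diff:
  fixes x :: "'a::ring fps"
  shows "param_mult (x - y) = param_mult x - param_mult y"
proof (rule fps_ext)
  show "fps_nth (param_mult (x - y)) n = fps_nth (param_mult x - param_mult y) n" for n
    by (cases n) auto
qed

text \<open>
  A formal product with biadditive coefficients up to order \<open>k\<close>. Biadditivity is what makes the
  associators of four elements cancel, and it holds at every order of a deformation.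
\<close>

locale truncated_product =
  fixes \<mu> :: "nat \<Rightarrow> 'a::ring list \<Rightarrow> 'a" and k :: nat
  assumes coeff_add_left: "s \<le> k \<Longrightarrow> \<mu> s [A + A', B] = \<mu> s [A, B] + \<mu> s [A', B]"
    and coeff_add_right: "s \<le> k \<Longrightarrow> \<mu> s [A, B + B'] = \<mu> s [A, B] + \<mu> s [A, B']"
begin

abbreviation dprod :: "'a fps \<Rightarrow> 'a fps \<Rightarrow> 'a fps" (infixl "\<star>" 70) where
  "a \<star> b \<equiv> deformed_product \<mu> k a b"

definition associator :: "'a fps \<Rightarrow> 'a fps \<Rightarrow> 'a fps \<Rightarrow> 'a fps" where
  "associator a b c = a \<star> b \<star> c - a \<star> (b \<star> c)"

lemma coeff_zero_left: "s \<le> k \<Longrightarrow> \<mu> s [0, B] = 0"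
  using coeff_add_left[of s 0 0 B] by simp

lemma coeff_zero_right: "s \<le> k \<Longrightarrow> \<mu> s [A, 0] = 0"
  using coeff_add_right[of s A 0 0] by simp

lemma dprod_nth:
  "fps_nth (a \<star> b) n = (\<Sum>s\<le>min k n. \<Sum>i\<le>n - s. \<mu> s [fps_nth a i, fps_nth b (n - s - i)])"
  by (simp add: deformed_product_def)

lemma dprod_add_left: "(a + a') \<star> b = a \<star> b + a' \<star> b"
  by (rule fps_ext) (simp add: dprod_nth coeff_add_left sum.distrib)

lemma dprod_add_right: "a \<star> (b + b') = a \<star> b + a \<star> b'"
  by (rule fps_ext) (simp add: dprod_nth coeff_add_right sum.distrib)

lemma dprod_diff_left: "(a - a') \<star> b = a \<star> b - a' \<star> b"
  using dprod_add_left[of "a - a'" a' b] by (simp add: algebra_simps)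

lemma dprod_diff_right: "a \<star> (b - b') = a \<star> b - a \<star> b'"
  using dprod_add_right[of a "b - b'" b'] by (simp add: algebra_simps)

lemma dprod_param_mult_left: "param_mult a \<star> b = param_mult (a \<star> b)"
proof (rule fps_ext)
  fix n
  show "fps_nth (param_mult a \<star> b) n = fps_nth (param_mult (a \<star> b)) n"
  proof (cases n)
    case 0
    then show ?thesis by (simp add: dprod_nth coeff_zero_left)
  next
    case (Suc m)
    have "fps_nth (param_mult a \<star> b) (Suc m) =
        (\<Sum>s\<le>min k m. \<Sum>i\<le>Suc m - s. \<mu> s [fps_nth (param_mult a) i, fps_nth b (Suc m - s - i)])"
      unfolding dprod_nth
      by (rule sum.mono_neutral_right) (auto simp: min_def coeff_zero_left not_le le_Suc_eq split: if_splits)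
    also have "\<dots> = fps_nth (a \<star> b) m"
      unfolding dprod_nth
    proof (rule sum.cong)
      fix s assume "s \<in> {..min k m}"
      then have "s \<le> k" "Suc m - s = Suc (m - s)" by auto
      then show "(\<Sum>i\<le>Suc m - s. \<mu> s [fps_nth (param_mult a) i, fps_nth b (Suc m - s - i)]) =
          (\<Sum>i\<le>m - s. \<mu> s [fps_nth a i, fps_nth b (m - s - i)])"
        by (simp add: sum.atMost_Suc_shift coeff_zero_left del: sum.atMost_Suc)
    qed simp
    finally show ?thesis by (simp add: Suc)
  qed
qed

lemma dprod_param_mult_right: "a \<star> param_mult b = param_mult (a \<star> b)"
proof (rule fps_ext)
  fix n
  show "fps_nth (a \<star> param_mult b) n = fps_nth (param_mult (a \<star> b)) n"
  proof (cases n)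
    case 0
    then show ?thesis by (simp add: dprod_nth coeff_zero_right)
  next
    case (Suc m)
    have "fps_nth (a \<star> param_mult b) (Suc m) =
        (\<Sum>s\<le>min k m. \<Sum>i\<le>Suc m - s. \<mu> s [fps_nth a i, fps_nth (param_mult b) (Suc m - s - i)])"
      unfolding dprod_nth
      by (rule sum.mono_neutral_right) (auto simp: min_def coeff_zero_right not_le le_Suc_eq split: if_splits)
    also have "\<dots> = fps_nth (a \<star> b) m"
      unfolding dprod_nth
    proof (rule sum.cong)
      fix s assume "s \<in> {..min k m}"
      then have "s \<le> k" "Suc m - s = Suc (m - s)" by auto
      then show "(\<Sum>i\<le>Suc m - s. \<mu> s [fps_nth a i, fps_nth (param_mult b) (Suc m - s - i)]) =
          (\<Sum>i\<le>m - s. \<mu> s [fps_nth a i, fps_nth b (m - s - i)])"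
        by (simp add: coeff_zero_right Suc_diff_le)
    qed simp
    finally show ?thesis by (simp add: Suc)
  qed
qed

lemma dprod_const_nth:
  "fps_nth (fps_const A \<star> b) n = (\<Sum>s\<le>min k n. \<mu> s [A, fps_nth b (n - s)])"
  unfolding dprod_nth
proof (rule sum.cong)
  fix s assume s: "s \<in> {..min k n}"
  then have "(\<Sum>i\<le>n - s. \<mu> s [fps_nth (fps_const A) i, fps_nth b (n - s - i)]) =
      (\<Sum>i\<le>n - s. if i = 0 then \<mu> s [A, fps_nth b (n - s)] else 0)"
    by (intro sum.cong) (auto simp: coeff_zero_left)
  then show "(\<Sum>i\<le>n - s. \<mu> s [fps_nth (fps_const A) i, fps_nth b (n - s - i)]) =
      \<mu> s [A, fps_nth b (n - s)]"
    by simp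
qed simp

lemma dprod_nth_const:
  "fps_nth (a \<star> fps_const B) n = (\<Sum>s\<le>min k n. \<mu> s [fps_nth a (n - s), B])"
  unfolding dprod_nth
proof (rule sum.cong)
  fix s assume s: "s \<in> {..min k n}"
  then have "(\<Sum>i\<le>n - s. \<mu> s [fps_nth a i, fps_nth (fps_const B) (n - s - i)]) =
      (\<Sum>i\<le>n - s. if i = n - s then \<mu> s [fps_nth a (n - s), B] else 0)"
    by (intro sum.cong) (auto simp: coeff_zero_right)
  then show "(\<Sum>i\<le>n - s. \<mu> s [fps_nth a i, fps_nth (fps_const B) (n - s - i)]) =
      \<mu> s [fps_nth a (n - s), B]"
    by simp
qed simp

lemma dprod_const_const_nth:
  "fps_nth (fps_const A \<star> fps_const B) n = (if n \<le> k then \<mu> n [A, B] else 0)"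
proof -
  have "fps_nth (fps_const A \<star> fps_const B) n =
      (\<Sum>s\<le>min k n. if s = n then \<mu> n [A, B] else 0)"
    unfolding dprod_const_nth by (rule sum.cong) (auto simp: coeff_zero_right)
  then show ?thesis by (simp add: min_def)
qed

lemma associator_const_nth:
  "fps_nth (associator (fps_const A) (fps_const B) (fps_const C)) n =
    (\<Sum>s\<le>min k n. if n - s \<le> k
       then \<mu> s [\<mu> (n - s) [A, B], C] - \<mu> s [A, \<mu> (n - s) [B, C]] else 0)"
  unfolding associator_def fps_sub_nth
    dprod_nth_const[of "fps_const A \<star> fps_const B"]
    dprod_const_nth[of _ "fps_const B \<star> fps_const C"]
    dprod_const_const_nth sum_subtractf[symmetric]
  by (rule sum.cong) (auto simp: coeff_zero_left coeff_zero_right)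

lemma associator_add:
  "associator (a + a') b c = associator a b c + associator a' b c"
  "associator a (b + b') c = associator a b c + associator a b' c"
  "associator a b (c + c') = associator a b c + associator a b c'"
  by (simp_all add: associator_def dprod_add_left dprod_add_right algebra_simps)

lemma associator_param_mult:
  "associator (param_mult a) b c = param_mult (associator a b c)"
  "associator a (param_mult b) c = param_mult (associator a b c)"
  "associator a b (param_mult c) = param_mult (associator a b c)"
  by (simp_all add: associator_def dprod_param_mult_left dprod_param_mult_right param_mult_diff)

text \<open>
  Split each argument into its constant term and \<open>\<lambda>\<close> times a series. The second part contributes
  \<open>\<lambda>\<close> times an associator, whose coefficient at order \<open>n\<close> is one of order \<open>n - 1\<close> and vanishes.
\<close>

lemma associator_lowest_coeff:
  assumes vanish: "\<And>a b c j. j < n \<Longrightarrow> fps_nth (associator a b c) j = 0"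
  shows "fps_nth (associator a b c) n =
    fps_nth (associator (fps_const (fps_nth a 0)) (fps_const (fps_nth b 0)) (fps_const (fps_nth c 0))) n"
proof -
  have shifted: "fps_nth (param_mult (associator a b c)) n = 0" for a b c
    using vanish by (cases n) auto
  have "fps_nth (associator a b c) n = fps_nth (associator (fps_const (fps_nth a 0)) b c) n" for a b c
    by (subst fps_eq_const_plus_param_mult[of a])
      (simp add: associator_add associator_param_mult shifted)
  moreover have "fps_nth (associator a b c) n = fps_nth (associator a (fps_const (fps_nth b 0)) c) n" for a b c
    by (subst fps_eq_const_plus_param_mult[of b])
      (simp add: associator_add associator_param_mult shifted)
  moreover have "fps_nth (associator a b c) n = fps_nth (associator a b (fps_const (fps_nth c 0))) n" for a b c
    by (subst fps_eq_const_plus_param_mult[of c])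
      (simp add: associator_add associator_param_mult shifted)
  ultimately show ?thesis by metis
qed

lemma associator_vanishes_below_iff:
  "(\<forall>a b c. \<forall>j<n. fps_nth (associator a b c) j = 0) \<longleftrightarrow>
   (\<forall>A B C. \<forall>j<n. fps_nth (associator (fps_const A) (fps_const B) (fps_const C)) j = 0)"
    (is "?series \<longleftrightarrow> ?const")
proof
  assume ?const
  then have "fps_nth (associator a b c) j = 0" if "j < n" for a b c j
    using that
  proof (induction j arbitrary: a b c rule: less_induct)
    case (less j)
    then have "fps_nth (associator a b c) j =
        fps_nth (associator (fps_const (fps_nth a 0)) (fps_const (fps_nth b 0)) (fps_const (fps_nth c 0))) j"
      by (intro associator_lowest_coeff) simp
    with less.prems show ?case by metis
  qed
  then show ?series by blast
qed blast

text \<open>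
  Written out, each of the five ways to bracket four factors occurs twice with opposite signs.
\<close>

lemma pentagon:
  "a \<star> associator b c d - associator (a \<star> b) c d + associator a (b \<star> c) d
    - associator a b (c \<star> d) + associator a b c \<star> d = 0"
  by (simp add: associator_def dprod_diff_left dprod_diff_right)

text \<open>
  The coefficient of order \<open>n\<close> of the pentagon identity on constants. In the two outer terms a
  series starting at order \<open>n\<close> is multiplied by a constant, so only \<open>\<mu> 0\<close> contributes; in the three
  inner terms a product of constants is replaced by its constant term, again given by \<open>\<mu> 0\<close>.
\<close>

lemma lowest_associator_coeff_cocycle:
  fixes n
  defines "e A B C \<equiv> fps_nth (associator (fps_const A) (fps_const B) (fps_const C)) n"
  assumes vanish: "\<And>a b c j. j < n \<Longrightarrow> fps_nth (associator a b c) j = 0"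
  shows "\<mu> 0 [A, e B C D] - e (\<mu> 0 [A, B]) C D + e A (\<mu> 0 [B, C]) D
    - e A B (\<mu> 0 [C, D]) + \<mu> 0 [e A B C, D] = 0"
proof -
  let ?c = fps_const
  have lowest: "fps_nth (associator a b c) n = e (fps_nth a 0) (fps_nth b 0) (fps_nth c 0)" for a b c
    unfolding e_def by (rule associator_lowest_coeff[OF vanish])
  have left: "fps_nth (?c A \<star> associator (?c B) (?c C) (?c D)) n = \<mu> 0 [A, e B C D]"
    unfolding dprod_const_nth
    by (subst sum.remove[of _ 0]) (auto simp: e_def vanish coeff_zero_right intro!: sum.neutral)
  have right: "fps_nth (associator (?c A) (?c B) (?c C) \<star> ?c D) n = \<mu> 0 [e A B C, D]"
    unfolding dprod_nth_const
    by (subst sum.remove[of _ 0]) (auto simp: e_def vanish coeff_zero_left intro!: sum.neutral)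
  have "fps_nth (?c A \<star> associator (?c B) (?c C) (?c D) - associator (?c A \<star> ?c B) (?c C) (?c D)
      + associator (?c A) (?c B \<star> ?c C) (?c D) - associator (?c A) (?c B) (?c C \<star> ?c D)
      + associator (?c A) (?c B) (?c C) \<star> ?c D) n = 0"
    by (simp only: pentagon fps_zero_nth)
  then show ?thesis
    by (simp only: fps_add_nth fps_sub_nth left right)
      (simp add: lowest dprod_const_const_nth)
qed

end


section \<open>Cochains and their star operation\<close>

lemma length_eq_2_iff: "length As = 2 \<longleftrightarrow> (\<exists>A B. As = [A, B])"
  and length_eq_3_iff: "length As = 3 \<longleftrightarrow> (\<exists>A B C. As = [A, B, C])"
  by (auto simp: numeral_eq_Suc length_Suc_conv)

lemma all_slots_2_iff:
  "(\<forall>As i. length As = 2 \<longrightarrow> i < 2 \<longrightarrow> P As i) \<longleftrightarrow> (\<forall>A B. P [A, B] 0 \<and> P [A, B] (Suc 0))"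
  unfolding length_eq_2_iff by (auto simp: numeral_eq_Suc less_Suc_eq)

lemma all_slots_3_iff:
  "(\<forall>As i. length As = 3 \<longrightarrow> i < 3 \<longrightarrow> P As i) \<longleftrightarrow>
    (\<forall>A B C. P [A, B, C] 0 \<and> P [A, B, C] (Suc 0) \<and> P [A, B, C] (Suc (Suc 0)))"
  unfolding length_eq_3_iff by (auto simp: numeral_eq_Suc less_Suc_eq)

lemma cochains_2_iff:
  "\<phi> \<in> cochains scale 2 \<longleftrightarrow>
    (\<forall>B. module_hom scale scale (\<lambda>A. \<phi> [A, B])) \<and>
    (\<forall>A. module_hom scale scale (\<lambda>B. \<phi> [A, B])) \<and>
    (\<forall>As. length As \<noteq> 2 \<longrightarrow> \<phi> As = 0)"
  unfolding cochains_def mem_Collect_eq all_slots_2_iff by auto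

lemma cochains_3_iff:
  "\<phi> \<in> cochains scale 3 \<longleftrightarrow>
    (\<forall>B C. module_hom scale scale (\<lambda>A. \<phi> [A, B, C])) \<and>
    (\<forall>A C. module_hom scale scale (\<lambda>B. \<phi> [A, B, C])) \<and>
    (\<forall>A B. module_hom scale scale (\<lambda>C. \<phi> [A, B, C])) \<and>
    (\<forall>As. length As \<noteq> 3 \<longrightarrow> \<phi> As = 0)"
  unfolding cochains_def mem_Collect_eq all_slots_3_iff by auto

sublocale star_algebra \<subseteq> star_hom: additive star
  by standard (rule star_add)

sublocale star_algebra \<subseteq> homs: module_pair scale scale ..

context star_algebra
begin

lemma product_cochain_in_cochains: "product_cochain \<in> cochains scale 2"
  by (simp add: cochains_2_iff product_cochain_def module_hom_iff module_axioms
      distrib_left distrib_right scale_mult_left scale_mult_right)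

lemma cochains_add: "\<phi> \<in> cochains scale n \<Longrightarrow> \<chi> \<in> cochains scale n \<Longrightarrow> \<phi> + \<chi> \<in> cochains scale n"
  by (auto simp: cochains_def intro: homs.module_hom_add)

lemma cochains_diff: "\<phi> \<in> cochains scale n \<Longrightarrow> \<chi> \<in> cochains scale n \<Longrightarrow> \<phi> - \<chi> \<in> cochains scale n"
  by (auto simp: cochains_def intro: homs.module_hom_sub)

lemma cochains_scale: "\<phi> \<in> cochains scale n \<Longrightarrow> (\<lambda>As. scale c (\<phi> As)) \<in> cochains scale n"
  by (auto simp: cochains_def intro: homs.module_hom_scale)

lemma zero_in_cochains: "0 \<in> cochains scale n"
  by (auto simp: cochains_def intro: homs.module_hom_zero)

text \<open>
  The star operation is antilinear, but conjugation is applied twice, to the arguments and to the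
  value, so that multilinearity over the scalars survives.
\<close>

lemma cochains_star:
  assumes \<phi>: "\<phi> \<in> cochains scale n"
  shows "cochain_star star \<phi> \<in> cochains scale n"
proof -
  have "module_hom scale scale (\<lambda>A. cochain_star star \<phi> (As[i := A]))"
    if "length As = n" "i < n" for As i
  proof -
    \<comment> \<open>reversal moves slot \<open>i\<close> to slot \<open>n - i - 1\<close>\<close>
    let ?f = "\<lambda>A. \<phi> ((map star (rev As))[n - i - 1 := A])"
    have "module_hom scale scale ?f"
      using \<phi> that by (simp add: cochains_def)
    then have "module_hom scale scale (\<lambda>A. star (?f (star A)))"
      by (simp add: module_hom_iff star_add star_scale qconj_def)
    then show ?thesis
      using that by (simp add: cochain_star_def rev_update map_update)
  qed
  then show ?thesis
    using \<phi> by (auto simp: cochains_def cochain_star_def star_hom.zero)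
qed

lemma hochschild_diff_add:
  "hochschild_diff scale n (\<phi> + \<chi>) = hochschild_diff scale n \<phi> + hochschild_diff scale n \<chi>"
  by (rule ext) (simp add: hochschild_diff_def algebra_simps sum.distrib)

lemma hochschild_diff_diff:
  "hochschild_diff scale n (\<phi> - \<chi>) = hochschild_diff scale n \<phi> - hochschild_diff scale n \<chi>"
  by (rule ext) (simp add: hochschild_diff_def algebra_simps sum_subtractf)

lemma hochschild_diff_scale:
  "hochschild_diff scale n (\<lambda>As. scale c (\<phi> As)) = (\<lambda>As. scale c (hochschild_diff scale n \<phi> As))"
  by (rule ext) (simp add: hochschild_diff_def scale_right_distrib scale_sum_right
      scale_right_diff_distrib scale_mult_left scale_mult_right mult.commute)

lemma hochschild_diff_2:
  "hochschild_diff scale 2 \<phi> [A, B, C] = A * \<phi> [B, C] - \<phi> [A * B, C] + \<phi> [A, B * C] - \<phi> [A, B] * C"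
  by (simp add: hochschild_diff_def numeral_eq_Suc)

lemma hochschild_diff_3:
  "hochschild_diff scale 3 \<phi> [A, B, C, D] =
    A * \<phi> [B, C, D] - \<phi> [A * B, C, D] + \<phi> [A, B * C, D] - \<phi> [A, B, C * D] + \<phi> [A, B, C] * D"
  by (simp add: hochschild_diff_def numeral_eq_Suc)

lemma hochschild_diff_2_eq_iff:
  assumes "\<And>As. length As \<noteq> 3 \<Longrightarrow> \<chi> As = 0"
  shows "hochschild_diff scale 2 \<phi> = \<chi> \<longleftrightarrow>
    (\<forall>A B C. hochschild_diff scale 2 \<phi> [A, B, C] = \<chi> [A, B, C])"
proof
  assume *: "\<forall>A B C. hochschild_diff scale 2 \<phi> [A, B, C] = \<chi> [A, B, C]"
  show "hochschild_diff scale 2 \<phi> = \<chi>"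
  proof
    show "hochschild_diff scale 2 \<phi> As = \<chi> As" for As
    proof (cases "length As = 3")
      case True
      with * show ?thesis by (auto simp: length_eq_3_iff)
    next
      case False
      with assms show ?thesis by (simp add: hochschild_diff_def)
    qed
  qed
qed simp

lemma cochain_star_add: "cochain_star star (\<phi> + \<chi>) = cochain_star star \<phi> + cochain_star star \<chi>"
  by (rule ext) (simp add: cochain_star_def star_add)

lemma cochain_star_diff: "cochain_star star (\<phi> - \<chi>) = cochain_star star \<phi> - cochain_star star \<chi>"
  by (rule ext) (simp add: cochain_star_def star_hom.diff)

lemma cochain_star_scale:
  "cochain_star star (\<lambda>As. scale c (\<phi> As)) = (\<lambda>As. scale (qconj c) (cochain_star star \<phi> As))"
  by (rule ext) (simp add: cochain_star_def star_scale)

lemma cochain_star_involutive: "cochain_star star (cochain_star star \<phi>) = \<phi>"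
  by (rule ext) (simp add: cochain_star_def star_star rev_map o_def)

text \<open>
  Reversing the arguments exchanges the outer terms of the differential with each other, and
  likewise the inner ones; in degree 2 the members of each pair carry opposite signs.
\<close>

lemma hochschild_diff_2_star:
  "hochschild_diff scale 2 (cochain_star star \<phi>) = - cochain_star star (hochschild_diff scale 2 \<phi>)"
proof (subst hochschild_diff_2_eq_iff, goal_cases)
  case (1 As)
  then show ?case by (simp add: cochain_star_def hochschild_diff_def star_hom.zero)
next
  case 2
  show ?case
    by (simp add: hochschild_diff_2 cochain_star_def star_hom.diff star_add star_mult star_star)
qed


section \<open>Vanishing of Hermitian cohomology classes\<close>

lemma herm_coboundaries_diff:
  assumes "\<phi> \<in> herm_coboundaries scale star n" "\<chi> \<in> herm_coboundaries scale star n"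
  shows "\<phi> - \<chi> \<in> herm_coboundaries scale star n"
proof (cases n)
  case 0
  with assms show ?thesis by (simp add: herm_coboundaries_def)
next
  case (Suc m)
  let ?sym = "if even n then hermitian star else anti_hermitian star"
  obtain \<psi> where \<psi>: "\<phi> = hochschild_diff scale m \<psi>" "\<psi> \<in> cochains scale m" "?sym \<psi>" "hermitian star \<phi>"
    using assms(1) Suc by (auto simp: herm_coboundaries_def)
  obtain \<eta> where \<eta>: "\<chi> = hochschild_diff scale m \<eta>" "\<eta> \<in> cochains scale m" "?sym \<eta>" "hermitian star \<chi>"
    using assms(2) Suc by (auto simp: herm_coboundaries_def)
  have "\<phi> - \<chi> = hochschild_diff scale m (\<psi> - \<eta>)" "hermitian star (\<phi> - \<chi>)" "?sym (\<psi> - \<eta>)"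
    using \<psi> \<eta> by (auto simp: hochschild_diff_diff hermitian_def anti_hermitian_def cochain_star_diff)
  then show ?thesis
    using Suc cochains_diff[OF \<psi>(2) \<eta>(2)] by (auto simp: herm_coboundaries_def)
qed

lemma hochschild_diff_zero: "hochschild_diff scale n 0 = 0"
  using hochschild_diff_diff[of n 0 0] by simp

lemma cochain_star_zero: "cochain_star star 0 = 0"
  using cochain_star_diff[of 0 0] by simp

lemma zero_in_herm_cocycles: "0 \<in> herm_cocycles scale star n"
  by (simp add: herm_cocycles_def zero_in_cochains hochschild_diff_zero hermitian_def cochain_star_zero)

lemma zero_in_herm_coboundaries: "0 \<in> herm_coboundaries scale star n"
proof (cases n)
  case (Suc m)
  show ?thesis
    unfolding herm_coboundaries_def Suc
    by (auto simp: zero_in_cochains hochschild_diff_zero hermitian_def anti_hermitian_def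
        cochain_star_zero intro!: exI[of _ 0])
qed (simp add: herm_coboundaries_def)

lemma herm_class_eq_zero_iff:
  assumes \<phi>: "\<phi> \<in> herm_cocycles scale star n"
  shows "herm_class scale star n \<phi> = herm_class scale star n 0 \<longleftrightarrow> \<phi> \<in> herm_coboundaries scale star n"
    (is "?L \<longleftrightarrow> \<phi> \<in> ?B")
proof -
  have herm_class_eq: "herm_class scale star n \<chi> = {\<eta> \<in> herm_cocycles scale star n. \<chi> - \<eta> \<in> ?B}"
    if "\<chi> \<in> herm_cocycles scale star n" for \<chi>
    using that by (auto simp: herm_class_def herm_cohomologous_def)
  note zero = zero_in_herm_cocycles[of n]
  show ?thesis
  proof
    assume ?L
    have "0 \<in> herm_class scale star n 0"
      using zero zero_in_herm_coboundaries by (simp add: herm_class_eq)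
    with \<open>?L\<close> have "0 \<in> herm_class scale star n \<phi>" by simp
    then show "\<phi> \<in> ?B" using \<phi> by (simp add: herm_class_eq)
  next
    assume B: "\<phi> \<in> ?B"
    have "\<phi> - \<eta> \<in> ?B \<longleftrightarrow> 0 - \<eta> \<in> ?B" for \<eta>
    proof
      assume "\<phi> - \<eta> \<in> ?B"
      from herm_coboundaries_diff[OF this B] show "0 - \<eta> \<in> ?B" by simp
    next
      assume "0 - \<eta> \<in> ?B"
      from herm_coboundaries_diff[OF B herm_coboundaries_diff[OF zero_in_herm_coboundaries this]]
      show "\<phi> - \<eta> \<in> ?B" by simp
    qed
    then show ?L using \<phi> zero by (simp add: herm_class_eq)
  qed
qed

end


section \<open>Associativity order by order\<close>

definition associator_coeff :: "(nat \<Rightarrow> 'a::ring list \<Rightarrow> 'a) \<Rightarrow> nat \<Rightarrow> 'a \<Rightarrow> 'a \<Rightarrow> 'a \<Rightarrow> 'a" where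
  "associator_coeff \<mu> n A B C = (\<Sum>s\<le>n. \<mu> s [\<mu> (n - s) [A, B], C] - \<mu> s [A, \<mu> (n - s) [B, C]])"

context star_algebra
begin

lemma bilinear_simps:
  assumes "\<phi> \<in> cochains scale 2"
  shows "\<phi> [A + A', B] = \<phi> [A, B] + \<phi> [A', B]" "\<phi> [A, B + B'] = \<phi> [A, B] + \<phi> [A, B']"
    "\<phi> [scale c A, B] = scale c (\<phi> [A, B])" "\<phi> [A, scale c B] = scale c (\<phi> [A, B])"
  using assms by (simp_all add: cochains_2_iff module_hom_iff)

lemma truncated_product_cochains:
  assumes "\<mu> 0 = product_cochain" "\<forall>j\<in>{1..k}. \<mu> j \<in> cochains scale 2"
  shows "truncated_product \<mu> k"
proof
  have coch: "\<mu> s \<in> cochains scale 2" if "s \<le> k" for s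
    using that assms product_cochain_in_cochains by (cases s) auto
  show "\<mu> s [A + A', B] = \<mu> s [A, B] + \<mu> s [A', B]" if "s \<le> k" for s A A' B
    by (rule bilinear_simps[OF coch[OF that]])
  show "\<mu> s [A, B + B'] = \<mu> s [A, B] + \<mu> s [A, B']" if "s \<le> k" for s A B B'
    by (rule bilinear_simps[OF coch[OF that]])
qed

text \<open>
  By the argument on lowest coefficients it is enough to multiply constant series. The equations
  of order \<open>n\<close> obtained in this way involve \<open>k\<close> only through the range of \<open>n\<close>, so that deformations
  up to different orders can be compared.
\<close>

lemma associative_deformation_iff_coeff:
  "associative_deformation scale k \<mu> \<longleftrightarrow>
    \<mu> 0 = product_cochain \<and> (\<forall>j\<in>{1..k}. \<mu> j \<in> cochains scale 2) \<and>
    (\<forall>A B C. \<forall>n<k + 1. associator_coeff \<mu> n A B C = 0)"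
proof (cases "\<mu> 0 = product_cochain \<and> (\<forall>j\<in>{1..k}. \<mu> j \<in> cochains scale 2)")
  case True
  then interpret truncated_product \<mu> k
    using truncated_product_cochains by blast
  have "fps_nth (associator (fps_const A) (fps_const B) (fps_const C)) n = associator_coeff \<mu> n A B C"
    if "n < k + 1" for A B C n
    unfolding associator_const_nth associator_coeff_def
    using that by (intro sum.cong) auto
  then have "(\<forall>a b c. \<forall>n<k + 1. fps_nth (associator a b c) n = 0) \<longleftrightarrow>
      (\<forall>A B C. \<forall>n<k + 1. associator_coeff \<mu> n A B C = 0)"
    by (simp add: associator_vanishes_below_iff del: Suc_eq_plus1 add_Suc_right)
  with True show ?thesis
    by (simp add: associative_deformation_def associator_def)
qed (auto simp: associative_deformation_def)

text \<open>
  Coefficients below order \<open>r\<close> do not see \<open>\<nu>\<close>. At order \<open>r\<close> the summands with \<open>s = 0\<close> and \<open>s = r\<close>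
  combine \<open>\<nu>\<close> with the undeformed product and form \<open>- \<delta>\<nu>\<close>, while the rest is the obstruction.
\<close>

lemma associative_extension_iff:
  assumes r: "r \<ge> 1" and def: "associative_deformation scale (r - 1) \<mu>"
    and \<nu>: "\<nu> \<in> cochains scale 2"
  shows "associative_deformation scale r (\<mu>(r := \<nu>)) \<longleftrightarrow> hochschild_diff scale 2 \<nu> = obstruction \<mu> r"
proof -
  let ?\<mu> = "\<mu>(r := \<nu>)"
  have \<mu>0: "\<mu> 0 = product_cochain"
    using def by (simp add: associative_deformation_def)
  have lower: "associator_coeff ?\<mu> n A B C = 0" if "n < r" for n A B C
  proof -
    have "associator_coeff ?\<mu> n A B C = associator_coeff \<mu> n A B C"
      unfolding associator_coeff_def using that by (intro sum.cong) auto
    then show ?thesis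
      using def that r by (simp add: associative_deformation_iff_coeff)
  qed
  have top: "associator_coeff ?\<mu> r A B C = obstruction \<mu> r [A, B, C] - hochschild_diff scale 2 \<nu> [A, B, C]"
    for A B C
  proof -
    let ?t = "\<lambda>s. ?\<mu> s [?\<mu> (r - s) [A, B], C] - ?\<mu> s [A, ?\<mu> (r - s) [B, C]]"
    have "{..r} = insert 0 (insert r {1..r - 1})" using r by auto
    then have "associator_coeff ?\<mu> r A B C = ?t 0 + (?t r + sum ?t {1..r - 1})"
      unfolding associator_coeff_def using r by simp
    also have "sum ?t {1..r - 1} = obstruction \<mu> r [A, B, C]"
      by (auto simp: obstruction_def intro!: sum.cong)
    also have "?t 0 + (?t r + obstruction \<mu> r [A, B, C]) =
        obstruction \<mu> r [A, B, C] - hochschild_diff scale 2 \<nu> [A, B, C]"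
      using r by (simp add: \<mu>0 product_cochain_def hochschild_diff_2)
    finally show ?thesis .
  qed
  have "associative_deformation scale r ?\<mu> \<longleftrightarrow> (\<forall>A B C. associator_coeff ?\<mu> r A B C = 0)"
    using r def \<nu> lower by (auto simp: associative_deformation_iff_coeff \<mu>0 less_Suc_eq)
  also have "\<dots> \<longleftrightarrow> hochschild_diff scale 2 \<nu> = obstruction \<mu> r"
    by (subst hochschild_diff_2_eq_iff)
      (auto simp: top obstruction_def length_eq_3_iff split: list.split)
  finally show ?thesis .
qed

lemma hermitian_extension_iff:
  assumes r: "r \<ge> 1" and def: "hermitian_deformation scale star (r - 1) \<mu>"
    and \<nu>: "\<nu> \<in> cochains scale 2"
  shows "hermitian_deformation scale star r (\<mu>(r := \<nu>)) \<longleftrightarrow>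
    hochschild_diff scale 2 \<nu> = obstruction \<mu> r \<and> hermitian star \<nu>"
proof -
  have "associative_deformation scale (r - 1) \<mu>"
    using def by (simp add: hermitian_deformation_def)
  then show ?thesis
    using r def associative_extension_iff[OF r _ \<nu>, of \<mu>] by (auto simp: hermitian_deformation_def)
qed


section \<open>The obstruction and its primitives\<close>

lemma obstruction_in_cochains:
  assumes "\<And>s. 1 \<le> s \<Longrightarrow> s < r \<Longrightarrow> \<mu> s \<in> cochains scale 2"
  shows "obstruction \<mu> r \<in> cochains scale 3"
proof -
  have "module_hom scale scale (\<lambda>X. \<mu> s [\<mu> (r - s) [X, B], C] - \<mu> s [X, \<mu> (r - s) [B, C]])"
    "module_hom scale scale (\<lambda>X. \<mu> s [\<mu> (r - s) [A, X], C] - \<mu> s [A, \<mu> (r - s) [X, C]])"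
    "module_hom scale scale (\<lambda>X. \<mu> s [\<mu> (r - s) [A, B], X] - \<mu> s [A, \<mu> (r - s) [B, X]])"
    if "s \<in> {1..r - 1}" for s A B C
  proof -
    have "\<mu> s \<in> cochains scale 2" "\<mu> (r - s) \<in> cochains scale 2"
      using that by (auto intro!: assms)
    note bil = this[THEN bilinear_simps(1)] this[THEN bilinear_simps(2)]
      this[THEN bilinear_simps(3)] this[THEN bilinear_simps(4)]
    show "module_hom scale scale (\<lambda>X. \<mu> s [\<mu> (r - s) [X, B], C] - \<mu> s [X, \<mu> (r - s) [B, C]])"
      "module_hom scale scale (\<lambda>X. \<mu> s [\<mu> (r - s) [A, X], C] - \<mu> s [A, \<mu> (r - s) [X, C]])"
      "module_hom scale scale (\<lambda>X. \<mu> s [\<mu> (r - s) [A, B], X] - \<mu> s [A, \<mu> (r - s) [B, X]])"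
      by (simp_all add: module_hom_iff module_axioms bil scale_right_diff_distrib)
  qed
  then show ?thesis
    by (auto simp: cochains_3_iff obstruction_def module_axioms intro!: homs.module_hom_sum split: list.split)
qed

text \<open>
  The obstruction is the lowest coefficient of the associator of the product truncated at order
  \<open>r - 1\<close>: the truncation removes exactly the summands in which \<open>\<mu> r\<close> would appear.
\<close>

lemma obstruction_cocycle:
  assumes r: "r \<ge> 1" and def: "associative_deformation scale (r - 1) \<mu>"
  shows "hochschild_diff scale 3 (obstruction \<mu> r) = 0"
proof -
  have \<mu>0: "\<mu> 0 = product_cochain" and coch: "\<forall>j\<in>{1..r - 1}. \<mu> j \<in> cochains scale 2"
    using def by (simp_all add: associative_deformation_def)
  interpret truncated_product \<mu> "r - 1"
    using \<mu>0 coch by (rule truncated_product_cochains)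
  have vanish: "fps_nth (associator a b c) j = 0" if "j < r" for a b c j
    using def r that by (simp add: associative_deformation_def associator_def del: One_nat_def)
  have E: "fps_nth (associator (fps_const A) (fps_const B) (fps_const C)) r = obstruction \<mu> r [A, B, C]"
    for A B C
  proof -
    have range: "{..min (r - 1) r} = insert 0 {1..r - 1}" using r by auto
    have "(\<Sum>s = 1..r - 1. if r - s \<le> r - 1
          then \<mu> s [\<mu> (r - s) [A, B], C] - \<mu> s [A, \<mu> (r - s) [B, C]] else 0) =
        obstruction \<mu> r [A, B, C]"
      unfolding obstruction_def list.case by (rule sum.cong) auto
    then show ?thesis
      unfolding associator_const_nth range using r by auto
  qed
  have "hochschild_diff scale 3 (obstruction \<mu> r) [A, B, C, D] = 0" for A B C D
    using lowest_associator_coeff_cocycle[OF vanish, of r A B C D]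
    by (simp add: E \<mu>0 product_cochain_def hochschild_diff_3 del: One_nat_def)
  moreover have "\<exists>A B C D. As = [A, B, C, D]" if "length As = 4" for As :: "'a list"
    using that by (auto simp: numeral_eq_Suc length_Suc_conv)
  ultimately have "hochschild_diff scale 3 (obstruction \<mu> r) As = 0" if "length As = 4" for As
    using that by metis
  then show ?thesis
    by (intro ext) (auto simp: hochschild_diff_def)
qed

text \<open>
  For Hermitian \<open>\<mu> s\<close> the involution maps each of the two compositions in the obstruction to the
  other one with arguments reversed, which is a change of sign.
\<close>

lemma obstruction_star:
  assumes herm: "\<And>s. 1 \<le> s \<Longrightarrow> s < r \<Longrightarrow> hermitian star (\<mu> s)"
  shows "cochain_star star (obstruction \<mu> r) = - obstruction \<mu> r"
proof
  fix As
  have swap: "star (\<mu> s [A, B]) = \<mu> s [star B, star A]" if "1 \<le> s" "s < r" for s A B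
  proof -
    have "\<mu> s [star B, star A] = cochain_star star (\<mu> s) [star B, star A]"
      using herm[OF that] by (simp add: hermitian_def)
    then show ?thesis by (simp add: cochain_star_def star_star)
  qed
  show "cochain_star star (obstruction \<mu> r) As = (- obstruction \<mu> r) As"
  proof (cases "length As = 3")
    case True
    then obtain A B C where As: "As = [A, B, C]" by (auto simp: length_eq_3_iff)
    show ?thesis
      by (auto simp: As cochain_star_def obstruction_def star_hom.sum star_hom.diff swap star_star
          sum_negf[symmetric] intro!: sum.cong)
  next
    case False
    then have "obstruction \<mu> r As = 0" "obstruction \<mu> r (map star (rev As)) = 0"
      by (auto simp: obstruction_def length_eq_3_iff split: list.split)
    then show ?thesis by (simp add: cochain_star_def star_hom.zero)
  qed
qed

lemma qconj_imag_unit: "qconj imag_unit = - (imag_unit :: 'r qext)"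
  by (simp add: qconj_def imag_unit_def uminus_qext_def)

lemma hermitian_obstruction_in_herm_cocycles:
  assumes r: "r \<ge> 1" and def: "hermitian_deformation scale star (r - 1) \<mu>"
  shows "(\<lambda>As. scale imag_unit (obstruction \<mu> r As)) \<in> herm_cocycles scale star 3"
proof -
  have assoc: "associative_deformation scale (r - 1) \<mu>"
    and herm: "\<And>s. 1 \<le> s \<Longrightarrow> s < r \<Longrightarrow> hermitian star (\<mu> s)"
    using def by (auto simp: hermitian_deformation_def)
  have "\<And>s. 1 \<le> s \<Longrightarrow> s < r \<Longrightarrow> \<mu> s \<in> cochains scale 2"
    using assoc by (auto simp: associative_deformation_def)
  then have "(\<lambda>As. scale imag_unit (obstruction \<mu> r As)) \<in> cochains scale 3"
    by (intro cochains_scale obstruction_in_cochains)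
  moreover have "hochschild_diff scale 3 (\<lambda>As. scale imag_unit (obstruction \<mu> r As)) = 0"
    by (rule ext) (simp add: hochschild_diff_scale obstruction_cocycle[OF r assoc])
  moreover have "hermitian star (\<lambda>As. scale imag_unit (obstruction \<mu> r As))"
    by (simp add: hermitian_def cochain_star_scale obstruction_star[OF herm] qconj_imag_unit)
  ultimately show ?thesis by (simp add: herm_cocycles_def)
qed

text \<open>
  In odd degree the primitives of a coboundary are required to be anti-Hermitian. Multiplication
  by \<open>- i\<close> and \<open>i\<close> translates between these and Hermitian primitives of \<open>\<phi>\<close> itself.
\<close>

lemma imag_unit_scale_herm_coboundary_iff:
  assumes \<phi>: "cochain_star star \<phi> = - \<phi>"
  shows "(\<lambda>As. scale imag_unit (\<phi> As)) \<in> herm_coboundaries scale star 3 \<longleftrightarrow>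
    (\<exists>\<nu>\<in>cochains scale 2. hochschild_diff scale 2 \<nu> = \<phi> \<and> hermitian star \<nu>)"
proof -
  have coboundaries: "herm_coboundaries scale star 3 =
      {hochschild_diff scale 2 \<psi> | \<psi>. \<psi> \<in> cochains scale 2 \<and> anti_hermitian star \<psi> \<and>
        hermitian star (hochschild_diff scale 2 \<psi>)}"
    unfolding herm_coboundaries_def eval_nat_numeral(3) nat.case by simp
  have qconj_minus_imag_unit: "qconj (- imag_unit) = (imag_unit :: 'r qext)"
    by (simp add: qconj_def imag_unit_def uminus_qext_def)
  show ?thesis
  proof
    assume "(\<lambda>As. scale imag_unit (\<phi> As)) \<in> herm_coboundaries scale star 3"
    then obtain \<psi> where \<psi>: "\<psi> \<in> cochains scale 2" "anti_hermitian star \<psi>"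
      and d: "hochschild_diff scale 2 \<psi> = (\<lambda>As. scale imag_unit (\<phi> As))"
      by (auto simp: coboundaries)
    let ?\<nu> = "\<lambda>As. scale (- imag_unit) (\<psi> As)"
    have "hochschild_diff scale 2 ?\<nu> = \<phi>"
      unfolding hochschild_diff_scale d by (simp add: imag_unit_square)
    moreover have "hermitian star ?\<nu>"
      unfolding hermitian_def cochain_star_scale
      using \<psi>(2) by (simp add: anti_hermitian_def qconj_minus_imag_unit)
    moreover have "?\<nu> \<in> cochains scale 2"
      by (rule cochains_scale[OF \<psi>(1)])
    ultimately show "\<exists>\<nu>\<in>cochains scale 2. hochschild_diff scale 2 \<nu> = \<phi> \<and> hermitian star \<nu>"
      by blast
  next
    assume "\<exists>\<nu>\<in>cochains scale 2. hochschild_diff scale 2 \<nu> = \<phi> \<and> hermitian star \<nu>"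
    then obtain \<nu> where \<nu>: "\<nu> \<in> cochains scale 2" "hochschild_diff scale 2 \<nu> = \<phi>" "hermitian star \<nu>"
      by blast
    let ?\<psi> = "\<lambda>As. scale imag_unit (\<nu> As)"
    have d: "hochschild_diff scale 2 ?\<psi> = (\<lambda>As. scale imag_unit (\<phi> As))"
      by (simp add: hochschild_diff_scale \<nu>(2))
    have "anti_hermitian star ?\<psi>"
      using \<nu>(3) by (auto simp: anti_hermitian_def hermitian_def cochain_star_scale qconj_imag_unit)
    moreover have "hermitian star (\<lambda>As. scale imag_unit (\<phi> As))"
      by (simp add: hermitian_def cochain_star_scale \<phi> qconj_imag_unit)
    moreover note cochains_scale[OF \<nu>(1), of imag_unit]
    ultimately show "(\<lambda>As. scale imag_unit (\<phi> As)) \<in> herm_coboundaries scale star 3"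
      unfolding coboundaries using d by force
  qed
qed

text \<open>
  The primitive is replaced by the mean of itself and its star. The latter is a primitive of the
  same cochain, as both the star of \<open>\<delta>\<nu>\<close> and the interchange of star and differential change sign.
\<close>

lemma hermitian_primitive:
  assumes h: "2 * h = (1 :: 'r)"
    and \<nu>: "\<nu> \<in> cochains scale 2"
    and anti: "cochain_star star (hochschild_diff scale 2 \<nu>) = - hochschild_diff scale 2 \<nu>"
  shows "\<exists>\<nu>'\<in>cochains scale 2. hochschild_diff scale 2 \<nu>' = hochschild_diff scale 2 \<nu> \<and> hermitian star \<nu>'"
proof -
  \<comment> \<open>one half is fixed under conjugation, so the mean stays Hermitian\<close>
  let ?h = "QExt h 0"
  let ?sum = "\<nu> + cochain_star star \<nu>"
  let ?\<nu>' = "\<lambda>As. scale ?h (?sum As)"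
  have "?h + ?h = 1"
    using h by (simp add: plus_qext_def one_qext_def)
  then have halve: "scale ?h (X + X) = X" for X
    by (simp add: scale_right_distrib scale_left_distrib[symmetric])
  have doubled: "hochschild_diff scale 2 ?sum = hochschild_diff scale 2 \<nu> + hochschild_diff scale 2 \<nu>"
    by (simp add: hochschild_diff_add hochschild_diff_2_star anti)
  have "hochschild_diff scale 2 ?\<nu>' = (\<lambda>As. scale ?h (hochschild_diff scale 2 ?sum As))"
    by (rule hochschild_diff_scale)
  also have "\<dots> = hochschild_diff scale 2 \<nu>"
    unfolding doubled by (simp add: halve)
  finally have "hochschild_diff scale 2 ?\<nu>' = hochschild_diff scale 2 \<nu>" .
  moreover have "cochain_star star ?\<nu>' = ?\<nu>'"
    unfolding cochain_star_scale cochain_star_add cochain_star_involutive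
    by (simp add: qconj_def add.commute)
  moreover have "?\<nu>' \<in> cochains scale 2"
    by (rule cochains_scale[OF cochains_add[OF \<nu> cochains_star[OF \<nu>]]])
  ultimately show ?thesis by (auto simp: hermitian_def)
qed

end

theorem proposition3p1:
  fixes scale :: "'r::linordered_idom qext \<Rightarrow> 'a::ring \<Rightarrow> 'a"
    and star :: "'a \<Rightarrow> 'a"
    and \<mu> :: "nat \<Rightarrow> 'a list \<Rightarrow> 'a"
    and r :: nat
  assumes half: "\<exists>h::'r. 2 * h = 1"
    and alg: "star_algebra scale star"
    and r: "r \<ge> 1"
    and def: "hermitian_deformation scale star (r - 1) \<mu>"
  defines "iE \<equiv> (\<lambda>As. scale imag_unit (obstruction \<mu> r As))"
  shows "iE \<in> herm_cocycles scale star 3 \<and>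
     herm_class scale star 3 iE \<in> herm_cohomology scale star 3 \<and>
     ((\<exists>\<mu>\<^sub>r \<in> cochains scale 2. hermitian_deformation scale star r (\<mu>(r := \<mu>\<^sub>r))) \<longleftrightarrow>
        herm_class scale star 3 iE = herm_class scale star 3 0) \<and>
     ((\<exists>\<mu>\<^sub>r \<in> cochains scale 2. associative_deformation scale r (\<mu>(r := \<mu>\<^sub>r))) \<longrightarrow>
        (\<exists>\<mu>\<^sub>r' \<in> cochains scale 2. hermitian_deformation scale star r (\<mu>(r := \<mu>\<^sub>r'))))"
proof -
  interpret star_algebra scale star by (rule alg)
  let ?primitive = "\<lambda>\<nu>. hochschild_diff scale 2 \<nu> = obstruction \<mu> r"
  have assoc: "associative_deformation scale (r - 1) \<mu>"
    using def by (simp add: hermitian_deformation_def)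
  have anti: "cochain_star star (obstruction \<mu> r) = - obstruction \<mu> r"
    using def by (intro obstruction_star) (auto simp: hermitian_deformation_def)
  have iE: "iE \<in> herm_cocycles scale star 3"
    unfolding iE_def using r def by (rule hermitian_obstruction_in_herm_cocycles)
  then have "herm_class scale star 3 iE \<in> herm_cohomology scale star 3"
    unfolding herm_class_def herm_cohomology_def by (rule quotientI)
  moreover have "(\<exists>\<nu>\<in>cochains scale 2. hermitian_deformation scale star r (\<mu>(r := \<nu>))) \<longleftrightarrow>
      (\<exists>\<nu>\<in>cochains scale 2. ?primitive \<nu> \<and> hermitian star \<nu>)"
    using hermitian_extension_iff[OF r def] by blast
  moreover have "\<dots> \<longleftrightarrow> herm_class scale star 3 iE = herm_class scale star 3 0"
    unfolding herm_class_eq_zero_iff[OF iE] unfolding iE_def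
    by (rule imag_unit_scale_herm_coboundary_iff[OF anti, symmetric])
  moreover have "\<exists>\<nu>'\<in>cochains scale 2. ?primitive \<nu>' \<and> hermitian star \<nu>'"
    if "\<nu> \<in> cochains scale 2" "associative_deformation scale r (\<mu>(r := \<nu>))" for \<nu>
  proof -
    obtain h :: 'r where h: "2 * h = 1" using half by blast
    have "?primitive \<nu>"
      using that by (simp add: associative_extension_iff[OF r assoc])
    then show ?thesis
      using hermitian_primitive[OF h that(1)] anti by metis
  qed
  ultimately show ?thesis using iE by blast
qed

end
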